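(* Let $\mathcal{S}$ be a nonempty set with a scene space basis $\mathcal{B}$ and let $P$ be a program over $\mathcal{S}$. Say that a set of variables $S\subseteq\mathcal{B}$ satisfies the coincidence effect property of $P$ if for every $V$ with $S\subseteq V\subseteq\mathcal{B}$ and all $s_0,s_1,s_0'\in\mathcal{S}$: if $s_0\approx s_1$ on $\bigcup V$ and $P(s_0,s_0')$, then there exists $s_1'\in\mathcal{S}$ such that $P(s_1,s_1')$ and $s_0'\approx s_1'$ on $\bigcup V$. Then $FV(P)$ is the smallest such set: $FV(P)$ satisfies the coincidence effect property of $P$, and $FV(P)\subseteq S$ for every $S\subseteq\mathcal{B}$ satisfying the coincidence effect property of $P$.
   Context: Scenes. Let $\mathcal{S}$ be a nonempty set (of states). A scene on $\mathcal{S}$ is a function $A:\mathcal{S}\to\mathcal{S}\to\mathcal{S}$ satisfying for all $x,y,z$: $A\,(A\,x\,y)\,z = A\,x\,z$, $A\,x\,(A\,y\,z)=A\,x\,z$, $A\,x\,x=x$. Write $\bot = (\lambda s_1\,s_2.\ s_1)$, $\top=(\lambda s_1\,s_2.\ s_2)$, $A^{\complement}=(\lambda s_1\,s_2.\ A\,s_2\,s_1)$, $A\sqcup B=(\lambda s_1\,s_2.\ B\,(A\,s_1\,s_2)\,s_2)$. Scenes $A,B$ are independent if $B\,(A\,s_1\,s_2)\,s_3=A\,(B\,s_1\,s_3)\,s_2$ for all $s_1,s_2,s_3$. Write "$s_1\approx s_2$ on $A$" for $A\,s_1\,s_2=s_1$. A scene space basis is a finite sequence of scenes $S_1,\dots,S_n$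 with $S_i,S_j$ independent for $i\neq j$ and $S_1\sqcup\cdots\sqcup S_n=\top$; $\mathcal{B}=\{S_1,\dots,S_n\}$ (the variables). For a set $X\subseteq\mathcal{B}$, $\bigcup X$ denotes the $\sqcup$ of all its elements (in any order, the result being independent of it), with $\bigcup\emptyset=\bot$. A program is a binary predicate $P(s,s')$ on $\mathcal{S}$. Free variables of a program: $FV(P)$ is the set of $x\in\mathcal{B}$ for which there exist $s_0,s_0',s_1\in\mathcal{S}$ such that $s_0\approx s_1$ on $x^{\complement}$, $P(s_0,s_0')$, and there is no $s_1'$ with $s_0'\approx s_1'$ on $x^{\complement}$ and $P(s_1,s_1')$. *)

theory Defs
  imports Main
begin

text \<open>The nonempty set of states is the type \<open>'s\<close>.\<close>

type_synonym 's scene = "'s \<Rightarrow> 's \<Rightarrow> 's"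

definition scene :: "'s scene \<Rightarrow> bool" where
  "scene A \<longleftrightarrow>
     (\<forall>x y z. A (A x y) z = A x z) \<and>
     (\<forall>x y z. A x (A y z) = A x z) \<and>
     (\<forall>x. A x x = x)"

definition scene_bot :: "'s scene"  ("\<bottom>\<^sub>S") where
  "\<bottom>\<^sub>S = (\<lambda>s\<^sub>1 s\<^sub>2. s\<^sub>1)"

definition scene_top :: "'s scene"  ("\<top>\<^sub>S") where
  "\<top>\<^sub>S = (\<lambda>s\<^sub>1 s\<^sub>2. s\<^sub>2)"

definition scene_compl :: "'s scene \<Rightarrow> 's scene"  ("-\<^sub>S _" [81] 80) where
  "-\<^sub>S A = (\<lambda>s\<^sub>1 s\<^sub>2. A s\<^sub>2 s\<^sub>1)"

definition scene_join :: "'s scene \<Rightarrow> 's scene \<Rightarrow> 's scene"  (infixl "\<squnion>\<^sub>S" 65) where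
  "A \<squnion>\<^sub>S B = (\<lambda>s\<^sub>1 s\<^sub>2. B (A s\<^sub>1 s\<^sub>2) s\<^sub>2)"

definition scene_indep :: "'s scene \<Rightarrow> 's scene \<Rightarrow> bool" where
  "scene_indep A B \<longleftrightarrow> (\<forall>s\<^sub>1 s\<^sub>2 s\<^sub>3. B (A s\<^sub>1 s\<^sub>2) s\<^sub>3 = A (B s\<^sub>1 s\<^sub>3) s\<^sub>2)"

definition scene_equiv :: "'s \<Rightarrow> 's \<Rightarrow> 's scene \<Rightarrow> bool"  ("_ \<approx> _ on _" [51, 51, 51] 50) where
  "s\<^sub>1 \<approx> s\<^sub>2 on A \<longleftrightarrow> A s\<^sub>1 s\<^sub>2 = s\<^sub>1"

text \<open>A basis is a list, so independence is required of distinct positions rather than of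
  distinct scenes. The variables are the elements of \<open>set Bs\<close>.\<close>

definition scene_space_basis :: "'s scene list \<Rightarrow> bool" where
  "scene_space_basis Bs \<longleftrightarrow>
     (\<forall>A \<in> set Bs. scene A) \<and>
     (\<forall>i < length Bs. \<forall>j < length Bs. i \<noteq> j \<longrightarrow> scene_indep (Bs ! i) (Bs ! j)) \<and>
     foldl (\<squnion>\<^sub>S) \<bottom>\<^sub>S Bs = \<top>\<^sub>S"

text \<open>The fold below is meaningful for finite sets of pairwise independent scenes, since the join
  is commutative on these; the lemma \<open>scene_Union_set\<close> states that the result is then the join of
  the elements in any order.\<close>

definition scene_Union :: "'s scene set \<Rightarrow> 's scene"  ("\<Union>\<^sub>S _" [900] 900) where
  "\<Union>\<^sub>S X = Finite_Set.fold (\<lambda>A Z. Z \<squnion>\<^sub>S A) \<bottom>\<^sub>S X"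

definition FV :: "'s scene list \<Rightarrow> ('s \<Rightarrow> 's \<Rightarrow> bool) \<Rightarrow> 's scene set" where
  "FV Bs P = {x \<in> set Bs. \<exists>s\<^sub>0 s\<^sub>0' s\<^sub>1.
     (s\<^sub>0 \<approx> s\<^sub>1 on (-\<^sub>S x)) \<and> P s\<^sub>0 s\<^sub>0' \<and>
     \<not> (\<exists>s\<^sub>1'. (s\<^sub>0' \<approx> s\<^sub>1' on (-\<^sub>S x)) \<and> P s\<^sub>1 s\<^sub>1')}"

definition coincidence_effect ::
    "'s scene list \<Rightarrow> ('s \<Rightarrow> 's \<Rightarrow> bool) \<Rightarrow> 's scene set \<Rightarrow> bool" where
  "coincidence_effect Bs P S \<longleftrightarrow> S \<subseteq> set Bs \<and>
     (\<forall>V s\<^sub>0 s\<^sub>1 s\<^sub>0'. S \<subseteq> V \<and> V \<subseteq> set Bs \<and> (s\<^sub>0 \<approx> s\<^sub>1 on (\<Union>\<^sub>S V)) \<and> P s\<^sub>0 s\<^sub>0' \<longrightarrow>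
        (\<exists>s\<^sub>1'. P s\<^sub>1 s\<^sub>1' \<and> (s\<^sub>0' \<approx> s\<^sub>1' on (\<Union>\<^sub>S V))))"

lemma comp_fun_commute_on_join:
  assumes "pairwise scene_indep X"
  shows "comp_fun_commute_on X (\<lambda>A Z. Z \<squnion>\<^sub>S A)"
proof
  fix A B assume "A \<in> X" "B \<in> X"
  then have "A = B \<or> scene_indep A B"
    using assms by (auto simp: pairwise_def)
  then show "(\<lambda>Z. Z \<squnion>\<^sub>S B) \<circ> (\<lambda>Z. Z \<squnion>\<^sub>S A) = (\<lambda>Z. Z \<squnion>\<^sub>S A) \<circ> (\<lambda>Z. Z \<squnion>\<^sub>S B)"
    by (auto simp: fun_eq_iff scene_join_def scene_indep_def)
qed

lemma scene_Union_set:
  assumes "distinct xs" "pairwise scene_indep (set xs)"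
  shows "\<Union>\<^sub>S (set xs) = foldl (\<squnion>\<^sub>S) \<bottom>\<^sub>S xs"
  using assms
proof (induction xs rule: rev_induct)
  case Nil
  then show ?case by (simp add: scene_Union_def)
next
  case (snoc x xs)
  interpret comp_fun_commute_on "set (xs @ [x])" "\<lambda>A Z. Z \<squnion>\<^sub>S A"
    using snoc.prems(2) by (rule comp_fun_commute_on_join)
  have "\<Union>\<^sub>S (insert x (set xs)) = \<Union>\<^sub>S (set xs) \<squnion>\<^sub>S x"
    unfolding scene_Union_def using snoc.prems(1) by (subst fold_insert) auto
  moreover have "pairwise scene_indep (set xs)"
    using snoc.prems(2) by (rule pairwise_subset) auto
  ultimately show ?case using snoc by simp
qed

end

theory Submission imports Defs begin

text \<open>If \<open>s\<^sub>0\<close> and \<open>s\<^sub>1\<close> agree on \<open>\<Union>\<^sub>S V\<close>, then \<open>s\<^sub>1\<close> arises from \<open>s\<^sub>0\<close> by overwriting the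
  variables outside \<open>V\<close> one at a time. None of these is free if \<open>FV \<subseteq> V\<close>, so every single step can
  be matched on the output side by a change of the same variable only, which preserves agreement
  on the variables in \<open>V\<close>. For minimality, agreement on \<open>x\<^sup>\<complement>\<close> is the same as agreement on the join of
  all variables other than \<open>x\<close>.\<close>

lemma scene_overwrite: "scene A \<Longrightarrow> A (A x y) z = A x z"
  and scene_overwrite_right: "scene A \<Longrightarrow> A x (A y z) = A x z"
  and scene_same: "scene A \<Longrightarrow> A x x = x"
  by (auto simp: scene_def)

lemma scene_equiv_trans:
  assumes "scene A" "s \<approx> t on A" "t \<approx> u on A"
  shows "s \<approx> u on A"
  using assms unfolding scene_equiv_def by (metis scene_overwrite_right)

text \<open>Agreement off \<open>B\<close> means \<open>s = B t s\<close>; independence then lets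
  \<open>A\<close> act before \<open>B\<close>, where it only forms \<open>A t t = t\<close>. Thus a
  change confined to \<open>B\<close> is invisible on every scene independent of
  \<open>B\<close>.\<close>

lemma scene_indep_equiv_compl:
  assumes "scene A" "scene_indep A B" "s \<approx> t on (-\<^sub>S B)"
  shows "s \<approx> t on A"
  using assms unfolding scene_equiv_def scene_compl_def scene_indep_def
  by (metis scene_same)

lemma scene_overwrite_equiv_compl:
  assumes "scene A"
  shows "s \<approx> A s t on (-\<^sub>S A)"
  using assms by (simp add: scene_equiv_def scene_compl_def scene_overwrite scene_same)

text \<open>Repetitions in \<open>xs\<close> are harmless: overwriting again through the same scene
  replaces the earlier overwriting, so joining is idempotent as well as commutative here. Lists that
  overlap can therefore be concatenated.\<close>

lemma scene_Union_set_fold: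
  assumes "\<forall>A \<in> set xs. scene A" "pairwise scene_indep (set xs)"
  shows "(\<Union>\<^sub>S (set xs)) s t = fold (\<lambda>A s. A s t) xs s"
proof -
  interpret comp_fun_commute_on "set xs" "\<lambda>A Z. Z \<squnion>\<^sub>S A"
    using assms(2) by (rule comp_fun_commute_on_join)
  interpret comp_fun_idem_on "set xs" "\<lambda>A Z. Z \<squnion>\<^sub>S A"
    by standard (use assms(1) in \<open>auto simp: fun_eq_iff scene_join_def scene_overwrite\<close>)
  have "fold (\<lambda>A Z. Z \<squnion>\<^sub>S A) xs Z s t = fold (\<lambda>A s. A s t) xs (Z s t)" for Z
    by (induction xs arbitrary: Z) (auto simp: scene_join_def)
  moreover have "\<Union>\<^sub>S (set xs) = fold (\<lambda>A Z. Z \<squnion>\<^sub>S A) xs \<bottom>\<^sub>S"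
    unfolding scene_Union_def by (rule fold_set_fold) simp
  ultimately show ?thesis by (simp add: scene_bot_def)
qed

lemma scene_space_basis_pairwise_indep:
  assumes "scene_space_basis Bs"
  shows "pairwise scene_indep (set Bs)"
  using assms unfolding scene_space_basis_def pairwise_def by (metis in_set_conv_nth)

lemma scene_space_basis_fold:
  assumes "scene_space_basis Bs"
  shows "fold (\<lambda>A s. A s t) Bs s = t"
proof -
  have "foldl (\<squnion>\<^sub>S) Z Bs s t = fold (\<lambda>A s. A s t) Bs (Z s t)" for Z
    by (induction Bs arbitrary: Z) (auto simp: scene_join_def)
  then show ?thesis
    using assms by (metis scene_space_basis_def scene_bot_def scene_top_def)
qed

lemma scene_equiv_Union_set:
  assumes "\<forall>A \<in> set xs. scene A \<and> s \<approx> t on A" "pairwise scene_indep (set xs)"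
  shows "s \<approx> t on (\<Union>\<^sub>S (set xs))"
proof -
  have "fold (\<lambda>A s. A s t) xs s = s"
    using assms(1) by (induction xs) (auto simp: scene_equiv_def)
  then show ?thesis
    using assms by (simp add: scene_equiv_def scene_Union_set_fold)
qed

text \<open>Overwriting along \<open>vs @ ws\<close> turns \<open>s\<close> into \<open>t\<close>,
  since the whole basis joins to \<open>\<top>\<^sub>S\<close>. The \<open>vs\<close> stage leaves
  \<open>s\<close> fixed by assumption, so the \<open>ws\<close> stage alone produces
  \<open>t\<close>.\<close>

lemma scene_equiv_Union_overwrite_rest:
  assumes "scene_space_basis Bs" "set vs \<union> set ws = set Bs" "s \<approx> t on (\<Union>\<^sub>S (set vs))"
  shows "fold (\<lambda>A s. A s t) ws s = t"
proof -
  have sc: "\<forall>A \<in> set Bs. scene A"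
    using assms(1) by (simp add: scene_space_basis_def)
  have ind: "pairwise scene_indep (set Bs)"
    using assms(1) by (rule scene_space_basis_pairwise_indep)
  have set_eq: "set (vs @ ws) = set Bs" using assms(2) by simp
  have "t = (\<Union>\<^sub>S (set Bs)) s t"
    by (simp add: scene_Union_set_fold sc ind scene_space_basis_fold assms(1))
  also have "\<dots> = fold (\<lambda>A s. A s t) (vs @ ws) s"
    using scene_Union_set_fold[of "vs @ ws" s t] sc ind unfolding set_eq by simp
  also have "fold (\<lambda>A s. A s t) vs s = (\<Union>\<^sub>S (set vs)) s t"
    using sc ind assms(2) by (subst scene_Union_set_fold) (auto intro: pairwise_subset)
  then have "fold (\<lambda>A s. A s t) (vs @ ws) s = fold (\<lambda>A s. A s t) ws s"
    using assms(3) by (simp add: scene_equiv_def)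
  finally show ?thesis by simp
qed

lemma scene_equiv_Union_others:
  assumes "scene_space_basis Bs" "x \<in> set Bs"
  shows "s \<approx> t on (\<Union>\<^sub>S (set Bs - {x})) \<longleftrightarrow> s \<approx> t on (-\<^sub>S x)"
proof
  have sc: "\<forall>A \<in> set Bs. scene A"
    using assms(1) by (simp add: scene_space_basis_def)
  have ind: "pairwise scene_indep (set Bs)"
    using assms(1) by (rule scene_space_basis_pairwise_indep)
  have set_eq: "set (removeAll x Bs) = set Bs - {x}" by simp
  {
    assume "s \<approx> t on (\<Union>\<^sub>S (set Bs - {x}))"
    \<comment> \<open>With \<open>[x]\<close> as the remaining list this says
      \<open>x s t = t\<close>, so \<open>t\<close> differs from \<open>s\<close> only in
      \<open>x\<close>.\<close>
    then have "fold (\<lambda>A s. A s t) [x] s = t"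
      using assms by (intro scene_equiv_Union_overwrite_rest[where vs = "removeAll x Bs"]) auto
    then show "s \<approx> t on (-\<^sub>S x)"
      using scene_overwrite_equiv_compl[of x s t] sc assms(2) by simp
  next
    assume "s \<approx> t on (-\<^sub>S x)"
    then have "\<forall>A \<in> set (removeAll x Bs). scene A \<and> s \<approx> t on A"
      using sc ind assms(2) by (auto simp: pairwise_def intro: scene_indep_equiv_compl)
    moreover have "pairwise scene_indep (set (removeAll x Bs))"
      using ind by (rule pairwise_subset) auto
    ultimately show "s \<approx> t on (\<Union>\<^sub>S (set Bs - {x}))"
      using scene_equiv_Union_set set_eq by metis
  }
qed

text \<open>Induction with \<open>s\<close> and \<open>s'\<close> general, as each step moves both,
  while \<open>t\<close> remains the source of all new values. Agreement of outputs on variables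
  outside \<open>ws\<close> survives each step by independence and composes by transitivity.\<close>

lemma overwrite_non_free_variables:
  assumes "\<forall>A \<in> set Bs. scene A" "pairwise scene_indep (set Bs)"
    and "set ws \<subseteq> set Bs - FV Bs P" "P s s'"
  shows "\<exists>t'. P (fold (\<lambda>A s. A s t) ws s) t' \<and> (\<forall>A \<in> set Bs - set ws. s' \<approx> t' on A)"
  using assms(3,4)
proof (induction ws arbitrary: s s')
  case Nil
  then show ?case using assms(1) by (auto simp: scene_equiv_def scene_same)
next
  case (Cons w ws)
  then have w: "w \<in> set Bs" "w \<notin> FV Bs P" by auto
  then have "s \<approx> w s t on (-\<^sub>S w)"
    using assms(1) by (simp add: scene_overwrite_equiv_compl)
  \<comment> \<open>\<open>w\<close> is not free, so the initial states \<open>s\<close> and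
    \<open>w s t\<close> cannot witness it in \<open>FV\<close>.\<close>
  then obtain u' where u': "s' \<approx> u' on (-\<^sub>S w)" "P (w s t) u'"
    using w \<open>P s s'\<close> unfolding FV_def by blast
  then obtain t' where t': "P (fold (\<lambda>A s. A s t) ws (w s t)) t'"
      "\<forall>A \<in> set Bs - set ws. u' \<approx> t' on A"
    using Cons by (metis insert_subset list.simps(15))
  have "s' \<approx> t' on A" if A: "A \<in> set Bs - set (w # ws)" for A
  proof -
    have "scene A" "scene_indep A w"
      using A w assms(1,2) by (auto simp: pairwise_def)
    moreover from this have "s' \<approx> u' on A"
      using u'(1) by (rule scene_indep_equiv_compl)
    moreover have "u' \<approx> t' on A" using t'(2) A by simp
    ultimately show ?thesis by (metis scene_equiv_trans)
  qed
  then show ?case using t'(1) by auto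
qed

theorem lemma36:
  fixes Bs :: "'s scene list" and P :: "'s \<Rightarrow> 's \<Rightarrow> bool"
  assumes "scene_space_basis Bs"
  shows "coincidence_effect Bs P (FV Bs P) \<and>
         (\<forall>S. S \<subseteq> set Bs \<and> coincidence_effect Bs P S \<longrightarrow> FV Bs P \<subseteq> S)"
proof (intro conjI allI impI)
  have sc: "\<forall>A \<in> set Bs. scene A"
    using assms by (simp add: scene_space_basis_def)
  have ind: "pairwise scene_indep (set Bs)"
    using assms by (rule scene_space_basis_pairwise_indep)
  show "coincidence_effect Bs P (FV Bs P)"
    unfolding coincidence_effect_def
  proof (intro conjI allI impI)
    show "FV Bs P \<subseteq> set Bs" by (auto simp: FV_def)
  next
    fix V s\<^sub>0 s\<^sub>1 s\<^sub>0'
    assume *: "FV Bs P \<subseteq> V \<and> V \<subseteq> set Bs \<and> s\<^sub>0 \<approx> s\<^sub>1 on (\<Union>\<^sub>S V) \<and> P s\<^sub>0 s\<^sub>0'"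
    \<comment> \<open>Splitting the basis list fixes an order for the overwriting; the two parts
      cover the basis and share no variable.\<close>
    define vs where "vs = filter (\<lambda>A. A \<in> V) Bs"
    define ws where "ws = filter (\<lambda>A. A \<notin> V) Bs"
    have V: "set vs = V" using * by (auto simp: vs_def)
    have "fold (\<lambda>A s. A s s\<^sub>1) ws s\<^sub>0 = s\<^sub>1"
      using * by (intro scene_equiv_Union_overwrite_rest[OF assms, where vs = vs])
        (auto simp: V, auto simp: ws_def)
    moreover have "set ws \<subseteq> set Bs - FV Bs P" using * by (auto simp: ws_def)
    ultimately obtain s\<^sub>1' where s1': "P s\<^sub>1 s\<^sub>1'" "\<forall>A \<in> set Bs - set ws. s\<^sub>0' \<approx> s\<^sub>1' on A"
      using overwrite_non_free_variables[OF sc ind, of ws P s\<^sub>0 s\<^sub>0' s\<^sub>1] * by auto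
    have "\<forall>A \<in> set vs. scene A \<and> s\<^sub>0' \<approx> s\<^sub>1' on A"
      using sc s1'(2) by (auto simp: vs_def ws_def)
    moreover have "pairwise scene_indep (set vs)"
      using ind by (rule pairwise_subset) (auto simp: vs_def)
    ultimately have "s\<^sub>0' \<approx> s\<^sub>1' on (\<Union>\<^sub>S V)"
      using scene_equiv_Union_set V by metis
    then show "\<exists>s\<^sub>1'. P s\<^sub>1 s\<^sub>1' \<and> s\<^sub>0' \<approx> s\<^sub>1' on (\<Union>\<^sub>S V)"
      using s1'(1) by blast
  qed
next
  fix S assume S: "S \<subseteq> set Bs \<and> coincidence_effect Bs P S"
  show "FV Bs P \<subseteq> S"
  proof (rule ccontr)
    assume "\<not> FV Bs P \<subseteq> S"
    then obtain x s\<^sub>0 s\<^sub>0' s\<^sub>1 where x: "x \<in> set Bs" "x \<notin> S"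
      and s: "s\<^sub>0 \<approx> s\<^sub>1 on (-\<^sub>S x)" "P s\<^sub>0 s\<^sub>0'"
        "\<not> (\<exists>s\<^sub>1'. s\<^sub>0' \<approx> s\<^sub>1' on (-\<^sub>S x) \<and> P s\<^sub>1 s\<^sub>1')"
      unfolding FV_def by blast
    \<comment> \<open>The witness for \<open>V\<close> is the largest set of variables avoiding
      \<open>x\<close>; agreement on its join is agreement on the complement of \<open>x\<close>, as
      in \<open>FV\<close>.\<close>
    have "S \<subseteq> set Bs - {x}" using S x by auto
    moreover have "s\<^sub>0 \<approx> s\<^sub>1 on (\<Union>\<^sub>S (set Bs - {x}))"
      using s(1) scene_equiv_Union_others[OF assms x(1)] by simp
    ultimately obtain s\<^sub>1' where "P s\<^sub>1 s\<^sub>1'" "s\<^sub>0' \<approx> s\<^sub>1' on (\<Union>\<^sub>S (set Bs - {x}))"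
      using S s(2) unfolding coincidence_effect_def by (meson Diff_subset)
    then show False
      using s(3) scene_equiv_Union_others[OF assms x(1)] by auto
  qed
qed

end
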